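(* For every $x : B$ and every proof $i : \texttt{infinite\_dyn}\ x$: \texttt{bisimilar\_s (dyn x i) (match P x as b return P x = b -> infinite\_dyn x -> str A with | true => fun t i => SCons A (h x) (dyn (g x) (dyn\_step1 x t i)) | false => fun t i => dyn (g' x) (dyn\_step2 x t i) end (refl\_equal (P x)) i)}. That is, if $P\,x = \texttt{true}$ then $\texttt{dyn}\ x\ i$ is bisimilar to $\texttt{SCons}\ (h\,x)\ (\texttt{dyn}\ (g\,x)\ i_1)$, and if $P\,x = \texttt{false}$ then $\texttt{dyn}\ x\ i$ is bisimilar to $\texttt{dyn}\ (g'\,x)\ i_2$, where $i_1, i_2$ are the proofs of $\texttt{infinite\_dyn}\ (g\,x)$, resp. $\texttt{infinite\_dyn}\ (g'\,x)$, given by \texttt{dyn\_step1}, resp. \texttt{dyn\_step2}.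
   Context: Work in Coq. Sets $A, B$; $P : B \to \texttt{bool}$; $h : B \to A$; $g, g' : B \to B$. Streams: \texttt{CoInductive str (A:Set) : Set := SCons : A -> str A -> str A.} Bisimilarity: \texttt{CoInductive bisimilar\_s : str A -> str A -> Prop := bisim : forall (a : A) (s s' : str A), bisimilar\_s s s' -> bisimilar\_s (SCons A a s) (SCons A a s').} \texttt{Inductive eventually\_dyn : B -> Prop := | ev\_dyn1 : forall x, P x = true -> eventually\_dyn x | ev\_dyn2 : forall x, P x = false -> eventually\_dyn (g' x) -> eventually\_dyn x.} \texttt{pre\_dyn : forall x, eventually\_dyn x -> A * B} is defined by structural recursion on the proof argument: \texttt{pre\_dyn x d} $= (h\,x, g\,x)$ if $P\,x = \texttt{true}$, and \texttt{pre\_dyn (g' x) d'} if $P\,x = \texttt{false}$, where \texttt{d'} is the structurally smaller sub-proof of \texttt{eventually\_dyn (g' x)} obtained by inversion of \texttt{d}. \texttt{CoInductive infinite\_dyn : B -> Prop := di : forall x (d : eventually\_dyn x), infinite\_dyn (snd (pre\_dyn x d)) -> infinite\_dyn x.} Let \texttt{infinite\_eventually\_dyn : forall x, infinite\_dyn x -> eventually\_dyn x} (extracting the component of \texttt{di}) and \texttt{infinite\_always\_dyn : forall x, infinite\_dyn x -> forall e : eventually\_dyn x, infinite\_dyn (snd (pre\_dyn x e))} be proofs of these statements, and define \texttt{CoFixpoint dyn (x:B) (i:infinite\_dyn x) : str A := SCons A (fst (pre\_dyn x (infinite\_eventually\_dyn x i))) (dyn \_ (infinite\_always\_dyn x i (infinite\_eventually\_dyn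 x i))).} \texttt{dyn\_step1 : forall x, P x = true -> infinite\_dyn x -> infinite\_dyn (g x)} and \texttt{dyn\_step2 : forall x, P x = false -> infinite\_dyn x -> infinite\_dyn (g' x)} denote proofs of these two statements. *)

theory Defs
  imports "HOL-Library.Stream"
begin

text \<open>
  Streams are the codatatype \<^typ>\<open>'a stream\<close>, with \<open>a ## s\<close> for \<open>SCons A a s\<close>.
  \<open>bisimilar_s\<close> keeps its coinductive definition instead of being replaced by equality.
\<close>

coinductive bisimilar_s :: "'a stream \<Rightarrow> 'a stream \<Rightarrow> bool" where
  bisim: "bisimilar_s s s' \<Longrightarrow> bisimilar_s (a ## s) (a ## s')"

text \<open>
  HOL has no proof objects, but \<open>pre_dyn\<close> is defined by recursion on a proof of
  \<open>eventually_dyn x\<close> and \<open>dyn\<close> takes a proof of \<open>infinite_dyn x\<close> as an argument. The proof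
  terms are therefore made explicit: their untyped syntax is a (co)datatype, and
  \<open>eventually_dyn P g' x d\<close> is the typing judgement
  ``\<open>d\<close> is a proof of \<open>eventually_dyn x\<close>'', with one introduction rule per Coq constructor.
  Likewise for \<open>infinite_dyn\<close>. The proofs of \<open>P x = true\<close> and \<open>P x = false\<close> are left out of the
  terms and are ordinary premises of the rules: an equation between booleans has at most one
  proof.
\<close>

datatype 'b eventually_prf = Ev_dyn1 'b | Ev_dyn2 'b "'b eventually_prf"

inductive eventually_dyn ::
    "('b \<Rightarrow> bool) \<Rightarrow> ('b \<Rightarrow> 'b) \<Rightarrow> 'b \<Rightarrow> 'b eventually_prf \<Rightarrow> bool"
  for P :: "'b \<Rightarrow> bool" and g' :: "'b \<Rightarrow> 'b" where
  ev_dyn1: "P x = True \<Longrightarrow> eventually_dyn P g' x (Ev_dyn1 x)"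
| ev_dyn2: "P x = False \<Longrightarrow> eventually_dyn P g' (g' x) d \<Longrightarrow> eventually_dyn P g' x (Ev_dyn2 x d)"

text \<open>
  Inverting a proof of \<open>eventually_dyn x\<close> when \<open>P x\<close> is false yields the subterm of \<open>Ev_dyn2\<close>; the
  branch \<open>undefined\<close> is reached only by terms that are not proofs of \<open>eventually_dyn x\<close>.
\<close>

primrec pre_dyn ::
    "('b \<Rightarrow> bool) \<Rightarrow> ('b \<Rightarrow> 'a) \<Rightarrow> ('b \<Rightarrow> 'b) \<Rightarrow> ('b \<Rightarrow> 'b) \<Rightarrow> 'b \<Rightarrow> 'b eventually_prf \<Rightarrow> 'a \<times> 'b" where
  "pre_dyn P h g g' x (Ev_dyn1 y) = (if P x then (h x, g x) else undefined)"
| "pre_dyn P h g g' x (Ev_dyn2 y d') = (if P x then (h x, g x) else pre_dyn P h g g' (g' x) d')"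

codatatype 'b infinite_prf =
  Di 'b (infinite_eventually_dyn: "'b eventually_prf") "'b infinite_prf"

coinductive infinite_dyn ::
    "('b \<Rightarrow> bool) \<Rightarrow> ('b \<Rightarrow> 'a) \<Rightarrow> ('b \<Rightarrow> 'b) \<Rightarrow> ('b \<Rightarrow> 'b) \<Rightarrow> 'b \<Rightarrow> 'b infinite_prf \<Rightarrow> bool"
  for P :: "'b \<Rightarrow> bool" and h :: "'b \<Rightarrow> 'a" and g g' :: "'b \<Rightarrow> 'b" where
  di: "eventually_dyn P g' x d \<Longrightarrow> infinite_dyn P h g g' (snd (pre_dyn P h g g' x d)) i
    \<Longrightarrow> infinite_dyn P h g g' x (Di x d i)"

text \<open>
  The selector \<open>infinite_eventually_dyn\<close> extracts the component of \<open>di\<close>. The proof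
  \<open>infinite_always_dyn\<close>, a function on proofs whose body is left unspecified, is a parameter of
  \<open>dyn\<close>; it is assumed to have its stated type where \<open>dyn\<close> is used.
\<close>

primcorec dyn ::
    "('b \<Rightarrow> bool) \<Rightarrow> ('b \<Rightarrow> 'a) \<Rightarrow> ('b \<Rightarrow> 'b) \<Rightarrow> ('b \<Rightarrow> 'b)
      \<Rightarrow> ('b \<Rightarrow> 'b infinite_prf \<Rightarrow> 'b eventually_prf \<Rightarrow> 'b infinite_prf)
      \<Rightarrow> 'b \<Rightarrow> 'b infinite_prf \<Rightarrow> 'a stream" where
  "dyn P h g g' infinite_always_dyn x i =
     fst (pre_dyn P h g g' x (infinite_eventually_dyn i)) ##
     dyn P h g g' infinite_always_dyn
       (snd (pre_dyn P h g g' x (infinite_eventually_dyn i)))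
       (infinite_always_dyn x i (infinite_eventually_dyn i))"

end

theory Submission
  imports Defs
begin

text \<open>
  A boolean test at each point determines the derivation, so \<open>x\<close> has at most one proof of
  \<open>eventually_dyn\<close>. Hence the value of \<open>pre_dyn x\<close> depends on \<open>x\<close> alone, and it determines
  \<open>dyn x\<close> completely: it provides the head and the point at which \<open>dyn\<close> resumes, whatever proofs
  \<open>infinite_always_dyn\<close> supplies along the way. For \<open>P x\<close> false, \<open>x\<close> and \<open>g' x\<close> have the same value
  of \<open>pre_dyn\<close>; for \<open>P x\<close> true, that value is \<open>(h x, g x)\<close>.
\<close>

lemma bisimilar_s_refl: "bisimilar_s s s"
proof (coinduction arbitrary: s)
  case (bisimilar_s s)
  show ?case by (cases s) simp
qed

lemma eventually_dyn_unique:
  assumes "eventually_dyn P g' x d" "eventually_dyn P g' x e"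
  shows "d = e"
  using assms
proof (induction arbitrary: e)
  case (ev_dyn1 x)
  from ev_dyn1.prems ev_dyn1.hyps show ?case by cases simp_all
next
  case (ev_dyn2 x d)
  from ev_dyn2.prems ev_dyn2.hyps obtain e' where "e = Ev_dyn2 x e'" "eventually_dyn P g' (g' x) e'"
    by cases simp_all
  with ev_dyn2.IH show ?case by simp
qed

lemma pre_dyn_True: "P x \<Longrightarrow> pre_dyn P h g g' x d = (h x, g x)"
  by (cases d) simp_all

lemma pre_dyn_False:
  assumes "\<not> P x" "eventually_dyn P g' x d" "eventually_dyn P g' (g' x) d'"
  shows "pre_dyn P h g g' x d = pre_dyn P h g g' (g' x) d'"
  using assms(2)
proof cases
  case (ev_dyn2 e)
  from ev_dyn2(3) assms(3) have "e = d'" by (rule eventually_dyn_unique)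
  with ev_dyn2 show ?thesis by simp
qed (use assms(1) in simp)

lemma eventually_dyn_infinite_eventually_dyn:
  assumes "infinite_dyn P h g g' x i"
  shows "eventually_dyn P g' x (infinite_eventually_dyn i)"
  using assms by cases simp

lemma pre_dyn_infinite_eventually_dyn_unique:
  assumes "infinite_dyn P h g g' x i" "infinite_dyn P h g g' x j"
  shows "pre_dyn P h g g' x (infinite_eventually_dyn i)
    = pre_dyn P h g g' x (infinite_eventually_dyn j)"
  using eventually_dyn_unique[OF assms[THEN eventually_dyn_infinite_eventually_dyn]] by simp

locale infinite_always_dyn_proof =
  fixes P :: "'b \<Rightarrow> bool" and h :: "'b \<Rightarrow> 'a" and g g' :: "'b \<Rightarrow> 'b"
    and infinite_always_dyn :: "'b \<Rightarrow> 'b infinite_prf \<Rightarrow> 'b eventually_prf \<Rightarrow> 'b infinite_prf"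
  assumes infinite_always_dyn:
    "infinite_dyn P h g g' x i \<Longrightarrow> eventually_dyn P g' x d
      \<Longrightarrow> infinite_dyn P h g g' (snd (pre_dyn P h g g' x d)) (infinite_always_dyn x i d)"
begin

abbreviation infinite_at :: "'b \<Rightarrow> 'b infinite_prf \<Rightarrow> bool" where
  "infinite_at \<equiv> infinite_dyn P h g g'"

abbreviation pre_at :: "'b \<Rightarrow> 'b infinite_prf \<Rightarrow> 'a \<times> 'b" where
  "pre_at x i \<equiv> pre_dyn P h g g' x (infinite_eventually_dyn i)"

abbreviation tail_prf :: "'b \<Rightarrow> 'b infinite_prf \<Rightarrow> 'b infinite_prf" where
  "tail_prf x i \<equiv> infinite_always_dyn x i (infinite_eventually_dyn i)"

abbreviation dyn_at :: "'b \<Rightarrow> 'b infinite_prf \<Rightarrow> 'a stream" where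
  "dyn_at \<equiv> dyn P h g g' infinite_always_dyn"

lemma infinite_at_tail_prf: "infinite_at x i \<Longrightarrow> infinite_at (snd (pre_at x i)) (tail_prf x i)"
  by (simp add: infinite_always_dyn eventually_dyn_infinite_eventually_dyn)

lemma dyn_eq_if_pre_dyn_eq:
  assumes "infinite_at x i" "infinite_at y j" "pre_at x i = pre_at y j"
  shows "dyn_at x i = dyn_at y j"
  using assms
proof (coinduction arbitrary: x i y j)
  case (Eq_stream x i y j)
  define z where "z = snd (pre_at x i)"
  have tails: "infinite_at z (tail_prf x i)" "infinite_at z (tail_prf y j)"
    using Eq_stream(1,2)[THEN infinite_at_tail_prf] Eq_stream(3) by (simp_all add: z_def)
  then have "pre_at z (tail_prf x i) = pre_at z (tail_prf y j)"
    by (rule pre_dyn_infinite_eventually_dyn_unique)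
  moreover have "stl (dyn_at x i) = dyn_at z (tail_prf x i)"
    and "stl (dyn_at y j) = dyn_at z (tail_prf y j)"
    and "shd (dyn_at x i) = shd (dyn_at y j)"
    using Eq_stream(3) by (simp_all add: z_def)
  ultimately show ?case
    using tails by blast
qed

corollary dyn_proof_irrelevant:
  assumes "infinite_at x i" "infinite_at x j"
  shows "dyn_at x i = dyn_at x j"
  using assms by (intro dyn_eq_if_pre_dyn_eq pre_dyn_infinite_eventually_dyn_unique)

lemma dyn_True:
  assumes "P x" "infinite_at x i" "infinite_at (g x) i'"
  shows "dyn_at x i = h x ## dyn_at (g x) i'"
proof -
  have pre: "pre_at x i = (h x, g x)"
    using assms(1) by (rule pre_dyn_True)
  with infinite_at_tail_prf[OF assms(2)] have "infinite_at (g x) (tail_prf x i)"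
    by simp
  then have "dyn_at (g x) (tail_prf x i) = dyn_at (g x) i'"
    using assms(3) by (rule dyn_proof_irrelevant)
  with pre show ?thesis
    by (subst dyn.code) simp
qed

lemma dyn_False:
  assumes "\<not> P x" "infinite_at x i" "infinite_at (g' x) i'"
  shows "dyn_at x i = dyn_at (g' x) i'"
  using assms
  by (intro dyn_eq_if_pre_dyn_eq pre_dyn_False eventually_dyn_infinite_eventually_dyn)

end

theorem theorem7p4:
  fixes P :: "'b \<Rightarrow> bool" and h :: "'b \<Rightarrow> 'a" and g g' :: "'b \<Rightarrow> 'b"
    and infinite_always_dyn :: "'b \<Rightarrow> 'b infinite_prf \<Rightarrow> 'b eventually_prf \<Rightarrow> 'b infinite_prf"
    and dyn_step1 dyn_step2 :: "'b \<Rightarrow> 'b infinite_prf \<Rightarrow> 'b infinite_prf"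
    and x :: 'b and i :: "'b infinite_prf"
  assumes infinite_always_dyn:
      "\<And>y j e. infinite_dyn P h g g' y j \<Longrightarrow> eventually_dyn P g' y e
        \<Longrightarrow> infinite_dyn P h g g' (snd (pre_dyn P h g g' y e)) (infinite_always_dyn y j e)"
    and dyn_step1:
      "\<And>y j. P y = True \<Longrightarrow> infinite_dyn P h g g' y j
        \<Longrightarrow> infinite_dyn P h g g' (g y) (dyn_step1 y j)"
    and dyn_step2:
      "\<And>y j. P y = False \<Longrightarrow> infinite_dyn P h g g' y j
        \<Longrightarrow> infinite_dyn P h g g' (g' y) (dyn_step2 y j)"
    and i: "infinite_dyn P h g g' x i"
  shows "bisimilar_s (dyn P h g g' infinite_always_dyn x i)
           (case P x of
              True \<Rightarrow> h x ## dyn P h g g' infinite_always_dyn (g x) (dyn_step1 x i)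
            | False \<Rightarrow> dyn P h g g' infinite_always_dyn (g' x) (dyn_step2 x i))"
proof -
  interpret infinite_always_dyn_proof P h g g' infinite_always_dyn
    using infinite_always_dyn by unfold_locales
  show ?thesis
  proof (cases "P x")
    case True
    then have "infinite_dyn P h g g' (g x) (dyn_step1 x i)"
      using i by (simp add: dyn_step1)
    with True i show ?thesis
      by (simp add: dyn_True bisimilar_s_refl)
  next
    case False
    then have "infinite_dyn P h g g' (g' x) (dyn_step2 x i)"
      using i by (simp add: dyn_step2)
    with False i have "dyn_at x i = dyn_at (g' x) (dyn_step2 x i)"
      by (rule dyn_False)
    with False show ?thesis
      by (simp add: bisimilar_s_refl)
  qed
qed

end
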